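(* The language $\mathcal{L}(\mathcal{S}_{\varphi})$ of the suffix conjugate $(\mathcal{S}_{\varphi},H_{\varphi})$ of the Fibonacci subshift $(\mathcal{X}_{\varphi},T)$ is regular. An infinite word $\mathbf{s}\in\{0,1,2\}^{\mathbb N}$ is in $\mathcal{S}_{\varphi}$ if and only if it is the label of an infinite walk (starting at any vertex) on the directed labelled graph with vertices $q_1,q_3,q_4$ and edges $$q_1\xrightarrow{0}q_1,\quad q_1\xrightarrow{2}q_3,\quad q_3\xrightarrow{1}q_4,\quad q_4\xrightarrow{1}q_3,\quad q_4\xrightarrow{2}q_4 .$$ The mapping $H_{\varphi}\colon\mathcal{S}_{\varphi}\to\mathcal{S}_{\varphi}$ is given by $$H_{\varphi}(\mathbf{s})=\begin{cases}1\mathbf{z}&\text{if }\mathbf{s}=2\mathbf{z};\\ \lambda(x2)\mathbf{z}&\text{if }\mathbf{s}=ax2\mathbf{z}\text{ with }a\in\{0,1\},\ x\in\{0,1\}^{*};\\ \lambda(\mathbf{z})&\text{if }\mathbf{s}=a\mathbf{z}\text{ with }a\in\{0,1\}\text{ and }\mathbf{z}\in\{0,1\}^{\mathbb N},\end{cases}$$ where $\lambda$ is the morphism given by $\lambda(1)=0$, $\lambda(0)=2$, and $\lambda(2)=21$.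
   Context: $\varphi\colon\{0,1\}^*\to\{0,1\}^*$ is the Fibonacci morphism $0\mapsto01$, $1\mapsto0$; $\mathbf{f}=\varphi^{\omega}(0)=\lim_n\varphi^n(0)$ is the Fibonacci word; $T$ is the shift $(x_n)_{n\ge 0}\mapsto(x_{n+1})_{n\ge 0}$ on infinite words over any alphabet; $\mathcal{X}_{\varphi}$ is the closure of $\{T^k\mathbf{f}:k\ge0\}$ in $\{0,1\}^{\mathbb N}$. Let $S=\{0,1,2\}$ and let $c$ be given by $c(0)=0$, $c(1)=1$, $c(2)=01$ (a bijection from $S$ onto the set of nonempty suffixes of $\varphi(0),\varphi(1)$). For $\mathbf{s}=s_0s_1\cdots\in S^{\mathbb N}$ let $\pi(\mathbf{s})=c(s_0)\varphi(c(s_1))\varphi^{2}(c(s_2))\cdots$, and let $\mathcal{S}_{\varphi}=\{\mathbf{s}\in S^{\mathbb N}:\pi(\mathbf{s})\in\mathcal{X}_{\varphi}\}$. $\mathcal{L}(\mathcal{S}_\varphi)$ is the set of all finite factors of elements of $\mathcal{S}_\varphi$. The suffix conjugate of $(\mathcal{X}_\varphi,T)$ is $(\mathcal{S}_{\varphi},H_{\varphi})$ with $H_{\varphi}=T\circ G$, where $G\colon\mathcal{S}_{\varphi}\to\mathcal{S}_{\varphi}$ is defined as follows. Let $\mathbf{s}=s_0s_1\cdots\in\mathcal{S}_\varphi$. If there is a smallest $r\ge0$ with $|c(s_r)|\ge2$, write $c(s_r)=au$ with $a$ a letter and $u$ a nonempty word; then $G(\mathbf{s})=t_0t_1\cdots$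 with $t_i=c^{-1}(\varphi(c(s_i)))$ for $0\le i\le r-1$, $t_r=c^{-1}(\varphi(a))$, $t_{r+1}=c^{-1}(u)$, and $t_i=s_{i-1}$ for $i\ge r+2$. If every $c(s_i)$ is a letter, then $G(\mathbf{s})=t_0t_1\cdots$ with $t_i=c^{-1}(\varphi(c(s_i)))$ for all $i$. *)

theory Defs
  imports "HOL-Analysis.Function_Topology" "HOL-Library.Omega_Words_Fun"
begin

text \<open>
  Letters are natural numbers, finite words are lists, and infinite words are functions on the
  natural numbers as in \<^theory>\<open>HOL-Library.Omega_Words_Fun\<close>. Alphabets are given as explicit sets
  of letters; functions on letters have irrelevant values outside their alphabet.
\<close>

definition shift :: "'a word \<Rightarrow> 'a word" where
  "shift x = suffix 1 x"

definition morph :: "('a \<Rightarrow> 'b list) \<Rightarrow> 'a list \<Rightarrow> 'b list" where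
  "morph h w = concat (map h w)"

text \<open>
  The infinite word to which a sequence of finite words converges letterwise (unspecified if there
  is no such word).
\<close>

definition word_lim :: "(nat \<Rightarrow> 'a list) \<Rightarrow> 'a word" where
  "word_lim u = (THE x. \<forall>i. \<forall>\<^sub>F n in sequentially. i < length (u n) \<and> u n ! i = x i)"

lemma word_lim_eqI:
  assumes "\<And>i. \<forall>\<^sub>F n in sequentially. i < length (u n) \<and> u n ! i = x i"
  shows "word_lim u = x"
  unfolding word_lim_def
proof (rule the_equality)
  show "\<forall>i. \<forall>\<^sub>F n in sequentially. i < length (u n) \<and> u n ! i = x i"
    using assms by blast
next
  fix y assume y: "\<forall>i. \<forall>\<^sub>F n in sequentially. i < length (u n) \<and> u n ! i = y i"
  show "y = x"
  proof
    fix i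
    have "\<forall>\<^sub>F n in sequentially. y i = x i"
      using eventually_conj[OF assms[of i] y[rule_format, of i]]
      by (rule eventually_mono) auto
    then show "y i = x i" by simp
  qed
qed

definition morph_inf :: "('a \<Rightarrow> 'b list) \<Rightarrow> 'a word \<Rightarrow> 'b word" where
  "morph_inf h x = word_lim (\<lambda>n. morph h (prefix n x))"

text \<open>Regular languages over \<open>A\<close>: those recognized by a deterministic finite automaton.\<close>

definition regular_language :: "'a set \<Rightarrow> 'a list set \<Rightarrow> bool" where
  "regular_language A L \<longleftrightarrow> finite A \<and>
    (\<exists>(Q :: nat set) (\<delta> :: nat \<Rightarrow> 'a \<Rightarrow> nat) q\<^sub>0 F.
      finite Q \<and> q\<^sub>0 \<in> Q \<and> F \<subseteq> Q \<and> (\<forall>q\<in>Q. \<forall>a\<in>A. \<delta> q a \<in> Q) \<and>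
      L = {w \<in> lists A. foldl \<delta> q\<^sub>0 w \<in> F})"

definition factors :: "'a word set \<Rightarrow> 'a list set" where
  "factors X = {x [i \<rightarrow> j] | x i j. x \<in> X}"

definition infinite_walk_label :: "('q \<times> 'a \<times> 'q) set \<Rightarrow> 'a word \<Rightarrow> bool" where
  "infinite_walk_label E s \<longleftrightarrow> (\<exists>p :: nat \<Rightarrow> 'q. \<forall>i. (p i, s i, p (Suc i)) \<in> E)"

definition \<phi> :: "nat list \<Rightarrow> nat list" where
  "\<phi> = morph (\<lambda>a. if a = 0 then [0, 1] else if a = 1 then [0] else [])"

definition fib_word :: "nat word" where
  "fib_word = word_lim (\<lambda>n. (\<phi> ^^ n) [0])"

definition fib_subshift :: "nat word set" where
  "fib_subshift = product_topology (\<lambda>_ :: nat. discrete_topology {0, 1 :: nat}) UNIV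
     closure_of {(shift ^^ k) fib_word | k. True}"

text \<open>
  \<open>c_suf\<close> numbers the nonempty suffixes of \<open>\<phi> [0] = [0, 1]\<close> and \<open>\<phi> [1] = [0]\<close>.
\<close>

definition c_suf :: "nat \<Rightarrow> nat list" where
  "c_suf s = (if s = 0 then [0] else if s = 1 then [1] else if s = 2 then [0, 1] else [])"

definition c_suf_inv :: "nat list \<Rightarrow> nat" where
  "c_suf_inv = the_inv_into {0, 1, 2} c_suf"

lemma inj_on_c_suf: "inj_on c_suf {0, 1, 2}"
  by (auto simp: inj_on_def c_suf_def)

definition suffix_expansion :: "nat word \<Rightarrow> nat word" where
  "suffix_expansion s = word_lim (\<lambda>n. concat (map (\<lambda>i. (\<phi> ^^ i) (c_suf (s i))) [0..<n]))"

definition S_fib :: "nat word set" where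
  "S_fib = {s. range s \<subseteq> {0, 1, 2} \<and> suffix_expansion s \<in> fib_subshift}"

definition G_fib :: "nat word \<Rightarrow> nat word" where
  "G_fib s =
    (if \<exists>r. length (c_suf (s r)) \<ge> 2 then
       (let r = (LEAST r. length (c_suf (s r)) \<ge> 2) in
        (\<lambda>i. if i < r then c_suf_inv (\<phi> (c_suf (s i)))
             else if i = r then c_suf_inv (\<phi> [hd (c_suf (s r))])
             else if i = r + 1 then c_suf_inv (tl (c_suf (s r)))
             else s (i - 1)))
     else (\<lambda>i. c_suf_inv (\<phi> (c_suf (s i)))))"

definition H_fib :: "nat word \<Rightarrow> nat word" where
  "H_fib s = shift (G_fib s)"

datatype vertex = q1 | q3 | q4

definition fib_graph :: "(vertex \<times> nat \<times> vertex) set" where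
  "fib_graph = {(q1, 0, q1), (q1, 2, q3), (q3, 1, q4), (q4, 1, q3), (q4, 2, q4)}"

definition lam :: "nat \<Rightarrow> nat list" where
  "lam a = (if a = 0 then [2] else if a = 1 then [0] else if a = 2 then [2, 1] else [])"

end

theory Submission
  imports Defs
begin

text \<open>
  A binary word belongs to the Fibonacci subshift exactly when each of its prefixes is a factor of
  the Fibonacci word (\<open>fib_subshift_iff\<close>). Hence \<open>s\<close> belongs to \<open>S_fib\<close> exactly when all the partial
  products \<open>p\<^sub>n(s) = c(s\<^sub>0) \<phi>(c(s\<^sub>1)) \<dots> \<phi>\<^sup>n\<^sup>-\<^sup>1(c(s\<^sub>n\<^sub>-\<^sub>1))\<close> are such factors, and these satisfy
  \<open>p\<^sub>n\<^sub>+\<^sub>1(s) = c(s\<^sub>0) \<phi>(p\<^sub>n(T s))\<close>.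

  The vertices of the graph record what may be written to the left of the expansion: \<open>q1\<close>, \<open>q3\<close>
  and \<open>q4\<close> stand for the words 1, 00 and 10. As the Fibonacci word is recurrent, every
  element of the subshift can be extended to the left by one of these three words. Suppose that the
  word \<open>u\<close> of a vertex may precede the expansion of \<open>s\<close>, that is, \<open>u c(s\<^sub>0) \<phi>(\<dots>)\<close> lies in the
  subshift. If \<open>u\<close> begins with 1, prepend the letter 0, which is the only letter that can precede 1.
  Then either \<open>u c(s\<^sub>0)\<close> contains 11 or yields 000, which is impossible, or \<open>u c(s\<^sub>0)\<close> is \<open>\<phi>(v)\<close> for
  a word \<open>v\<close>, and by unique desubstitution \<open>v\<close> may precede the expansion of \<open>T s\<close>. Running through
  the nine cases gives precisely the five edges of the graph (\<open>left_admissible_step\<close>). Conversely,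
  reading a walk backwards, each edge transports factors to factors (\<open>fib_factor_along_edge\<close>),
  because \<open>\<phi>\<close> maps factors to factors.

  So \<open>S_fib\<close> is the set of labels of infinite walks. As every vertex starts an infinite walk, the
  language of \<open>S_fib\<close> consists of the labels of finite walks, and the subset construction makes it
  regular. The formula for \<open>H_fib\<close> unfolds the definition of \<open>G_fib\<close>: on single letters,
  the map \<open>c\<^sup>-\<^sup>1 \<phi> c\<close> is \<open>\<lambda>\<close>, and at the first occurrence of 2 the two letters 2 and 1 are created.
  That \<open>H_fib\<close> preserves \<open>S_fib\<close> can then be read off the graph.
\<close>

section \<open>Factors of the Fibonacci word\<close>

lemma phi_Nil [simp]: "\<phi> [] = []"
  by (simp add: \<phi>_def morph_def)

lemma phi_Cons:
  "\<phi> (a # w) = (if a = 0 then [0, 1] else if a = 1 then [0] else []) @ \<phi> w"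
  by (simp add: \<phi>_def morph_def)

lemma phi_Cons_letter [simp]:
  "\<phi> (0 # w) = 0 # 1 # \<phi> w" "\<phi> (Suc 0 # w) = 0 # \<phi> w"
  by (simp_all add: phi_Cons)

lemma phi_append [simp]: "\<phi> (u @ v) = \<phi> u @ \<phi> v"
  by (simp add: \<phi>_def morph_def)

text \<open>
  \<open>\<phi>\<close> erases all letters other than 0 and 1, so its values are always binary words.
\<close>

lemma phi_in_lists: "\<phi> w \<in> lists {0, 1}"
  by (induction w) (auto simp: phi_Cons)

lemma phi_pow_in_lists: "w \<in> lists {0, 1} \<Longrightarrow> (\<phi> ^^ n) w \<in> lists {0, 1}"
  using phi_in_lists[of "(\<phi> ^^ (n - 1)) w"] by (cases n) simp_all

lemma phi_nonempty_starts_with_0: "w \<in> lists {0, 1} \<Longrightarrow> w \<noteq> [] \<Longrightarrow> \<exists>v. \<phi> w = 0 # v"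
  by (cases w) auto

lemma phi_pow_nonempty: "w \<in> lists {0, 1} \<Longrightarrow> w \<noteq> [] \<Longrightarrow> (\<phi> ^^ n) w \<noteq> []"
proof (induction n)
  case (Suc n)
  then show ?case
    using phi_nonempty_starts_with_0[OF phi_pow_in_lists, of w n] by auto
qed simp

lemma phi_pow_0_recurrence: "(\<phi> ^^ (n + 2)) [0] = (\<phi> ^^ (n + 1)) [0] @ (\<phi> ^^ n) [0]"
  by (induction n) auto

text \<open>
  Factors are taken in the finite words \<open>\<phi>\<^sup>n(0)\<close> instead of their limit, so that \<open>\<phi>\<close> and its iterates
  only ever act on finite words.
\<close>

definition fib_factor :: "nat list \<Rightarrow> bool" where
  "fib_factor w \<longleftrightarrow> (\<exists>n u v. (\<phi> ^^ n) [0] = u @ w @ v)"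

lemma fib_factor_infix: "fib_factor (u @ w @ v) \<Longrightarrow> fib_factor w"
  unfolding fib_factor_def
proof (elim exE)
  fix n x y assume "(\<phi> ^^ n) [0] = x @ (u @ w @ v) @ y"
  then have "(\<phi> ^^ n) [0] = (x @ u) @ w @ (v @ y)" by simp
  then show "\<exists>n x y. (\<phi> ^^ n) [0] = x @ w @ y" by blast
qed

lemma fib_factor_appendD1: "fib_factor (w @ v) \<Longrightarrow> fib_factor w"
  using fib_factor_infix[of "[]"] by simp

lemma fib_factor_appendD2: "fib_factor (u @ w) \<Longrightarrow> fib_factor w"
  using fib_factor_infix[of u w "[]"] by simp

lemma fib_factor_in_lists: "fib_factor w \<Longrightarrow> w \<in> lists {0, 1}"
proof -
  assume "fib_factor w"
  then obtain n u v where "(\<phi> ^^ n) [0] = u @ w @ v" by (auto simp: fib_factor_def)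
  then show ?thesis using phi_pow_in_lists[of "[0]" n] by auto
qed

lemma fib_factor_phi: "fib_factor w \<Longrightarrow> fib_factor (\<phi> w)"
proof -
  assume "fib_factor w"
  then obtain n u v where "(\<phi> ^^ n) [0] = u @ w @ v" by (auto simp: fib_factor_def)
  then have "(\<phi> ^^ Suc n) [0] = \<phi> u @ \<phi> w @ \<phi> v" by simp
  then show ?thesis unfolding fib_factor_def by blast
qed

text \<open>
  By \<open>\<phi>\<^sup>n\<^sup>+\<^sup>2(0) = \<phi>\<^sup>n\<^sup>+\<^sup>1(0) \<phi>\<^sup>n(0)\<close>, every factor occurs at a position other than the first one.
\<close>

lemma fib_factor_left_extension:
  assumes "fib_factor w"
  obtains a where "a \<in> {0, 1}" "fib_factor (a # w)"
proof -
  obtain n u v where w: "(\<phi> ^^ n) [0] = u @ w @ v" using assms by (auto simp: fib_factor_def)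
  define t where "t = (\<phi> ^^ (n + 1)) [0] @ u"
  have "t \<noteq> []" using phi_pow_nonempty[of "[0]" "n + 1"] by (simp add: t_def)
  then have "(\<phi> ^^ (n + 2)) [0] = butlast t @ (last t # w) @ v"
    unfolding phi_pow_0_recurrence w by (simp add: t_def)
  then have "fib_factor (last t # w)" unfolding fib_factor_def by blast
  then show thesis using that[of "last t"] fib_factor_in_lists[of "last t # w"] by simp
qed

text \<open>
  Synchronization: the images of both letters contain 0 exactly once, as their first letter, so
  every occurrence of 0 marks a boundary between two images.
\<close>

lemma phi_split_at_0:
  assumes "\<phi> v = x @ 0 # y" "v \<in> lists {0, 1}"
  obtains v1 v2 where "v = v1 @ v2" "\<phi> v1 = x" "\<phi> v2 = 0 # y"
proof -
  have "\<exists>v1 v2. v = v1 @ v2 \<and> \<phi> v1 = x \<and> \<phi> v2 = 0 # y"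
    using assms
  proof (induction v arbitrary: x)
    case (Cons a v)
    show ?case
    proof (cases "x = []")
      case True
      then have "a # v = [] @ (a # v) \<and> \<phi> [] = x \<and> \<phi> (a # v) = 0 # y"
        using Cons.prems by simp
      then show ?thesis by blast
    next
      case False
      have a: "a = 0 \<or> a = 1" using Cons.prems(2) by auto
      then obtain x' where x': "x = \<phi> [a] @ x'" "\<phi> v = x' @ 0 # y"
        using Cons.prems(1) False by (auto simp: Cons_eq_append_conv append_eq_Cons_conv)
      obtain v1 v2 where "v = v1 @ v2" "\<phi> v1 = x'" "\<phi> v2 = 0 # y"
        using Cons.IH[OF x'(2)] Cons.prems(2) by auto
      then show ?thesis
        using a x'(1) by (intro exI[of _ "a # v1"] exI[of _ v2]) auto
    qed
  qed simp
  then show thesis using that by blast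
qed

text \<open>
  The letter 0 after \<open>\<phi>(w)\<close> is needed for unique decoding, since \<open>\<phi>(1) = 0\<close> is a prefix of
  \<open>\<phi>(0) = 01\<close>.
\<close>

lemma phi_cancel_prefix:
  assumes "\<phi> v = \<phi> w @ 0 # y" "v \<in> lists {0, 1}" "w \<in> lists {0, 1}"
  obtains v' where "v = w @ v'"
proof -
  have "\<exists>v'. v = w @ v'"
    using assms
  proof (induction w arbitrary: v)
    case (Cons a w)
    obtain b v' where v: "v = b # v'" using Cons.prems by (cases v) (auto simp: phi_Cons)
    have ab: "a = 0 \<or> a = 1" "b = 0 \<or> b = 1" using Cons.prems v by auto
    have w: "w \<in> lists {0, 1}" "v' \<in> lists {0, 1}" using Cons.prems v by auto
    \<comment> \<open>The first letters are decoded by looking for a 1 at the second position of the image.\<close>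
    have no_1: "\<phi> v' \<noteq> 1 # t" "\<phi> w @ 0 # y \<noteq> 1 # t" for t
      using w by (cases v', auto simp: phi_Cons, cases w, auto simp: phi_Cons split: if_splits)
    have "a = b \<and> \<phi> v' = \<phi> w @ 0 # y"
      using ab no_1 no_1[symmetric] Cons.prems(1) unfolding v by auto
    then show ?case using Cons.IH[of v'] w v by auto
  qed simp
  then show thesis using that by blast
qed

text \<open>
  Unique desubstitution, the converse of \<open>fib_factor_phi\<close>: the final 0 delimits the last image.
\<close>

lemma fib_factor_desubstitute:
  assumes "fib_factor (\<phi> w @ [0])" "w \<in> lists {0, 1}"
  shows "fib_factor w"
proof (cases "w = []")
  case True
  then have "(\<phi> ^^ 0) [0] = [] @ w @ [0]" by simp
  then show ?thesis unfolding fib_factor_def by blast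
next
  case False
  obtain n u v where n: "(\<phi> ^^ n) [0] = u @ (\<phi> w @ [0]) @ v"
    using assms by (auto simp: fib_factor_def)
  obtain t where t: "\<phi> w = 0 # t" using phi_nonempty_starts_with_0 assms False by blast
  then obtain m where "n = Suc m"
    using n by (cases n) (auto simp: append_eq_Cons_conv Cons_eq_append_conv)
  then have "\<phi> ((\<phi> ^^ m) [0]) = u @ 0 # (t @ [0] @ v)" using n t by simp
  moreover have m: "(\<phi> ^^ m) [0] \<in> lists {0, 1}" by (rule phi_pow_in_lists) simp
  ultimately obtain v1 v2 where v: "(\<phi> ^^ m) [0] = v1 @ v2" "\<phi> v2 = 0 # (t @ [0] @ v)"
    by (rule phi_split_at_0)
  then have "\<phi> v2 = \<phi> w @ 0 # v" using t by simp
  then obtain v' where "v2 = w @ v'"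
    using phi_cancel_prefix[of v2 w v] assms(2) m v by auto
  then show ?thesis unfolding fib_factor_def using v by blast
qed

lemma not_fib_factor_11: "\<not> fib_factor [1, 1]"
proof
  have no_11: "\<phi> v \<noteq> u @ [1, 1] @ w" if "v \<in> lists {0, 1}" for u v w
  proof
    assume "\<phi> v = u @ [1, 1] @ w"
    then show False using that
    proof (induction v arbitrary: u)
      case (Cons a v)
      have "\<phi> v \<noteq> 1 # t" for t
        using Cons.prems(2) by (cases v) (auto simp: phi_Cons)
      then show False using Cons by (auto simp: phi_Cons Cons_eq_append_conv)
    qed simp
  qed
  assume "fib_factor [1, 1]"
  then obtain n u v where n: "(\<phi> ^^ n) [0] = u @ [1, 1] @ v" by (auto simp: fib_factor_def)
  then show False
  proof (cases n)
    case (Suc m)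
    then show False
      using n no_11[of "(\<phi> ^^ m) [0]" u v] phi_pow_in_lists[of "[0]" m] by simp
  qed (auto simp: Cons_eq_append_conv)
qed

lemma not_fib_factor_000: "\<not> fib_factor [0, 0, 0]"
proof
  assume "fib_factor [0, 0, 0]"
  then have "fib_factor (\<phi> [1, 1] @ [0])" by simp
  then have "fib_factor [1, 1]" by (rule fib_factor_desubstitute) simp
  then show False using not_fib_factor_11 by blast
qed

section \<open>The Fibonacci subshift\<close>

lemma prefix_word_lim:
  assumes extends: "\<And>n. \<exists>v. u (Suc n) = u n @ v" and long: "\<And>n. n \<le> length (u n)"
  shows "prefix (length (u n)) (word_lim u) = u n"
proof -
  have extends_le: "\<exists>v. u m = u n @ v" if "n \<le> m" for n m
    using that
  proof (induction m rule: dec_induct)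
    case (step m)
    then show ?case using extends[of m] by auto
  qed simp
  have agree: "u n ! i = u m ! i" if "i < length (u n)" "i < length (u m)" for i n m
    using extends_le[of n m] extends_le[of m n] that by (cases "n \<le> m") (auto simp: nth_append)
  have longer: "i < length (u n)" if "i < n" for i n using long[of n] that by linarith
  have "word_lim u = (\<lambda>i. u (Suc i) ! i)"
  proof (rule word_lim_eqI)
    fix i
    have "i < length (u n) \<and> u n ! i = u (Suc i) ! i" if "n \<ge> Suc i" for n
      using agree longer that by (simp add: less_eq_Suc_le)
    then show "\<forall>\<^sub>F n in sequentially. i < length (u n) \<and> u n ! i = u (Suc i) ! i"
      unfolding eventually_sequentially by blast
  qed
  then have "word_lim u i = u n ! i" if "i < length (u n)" for i
    using agree[of i "Suc i" n] longer[of i "Suc i"] that by simp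
  then show ?thesis by (intro nth_equalityI) simp_all
qed

lemma le_length_phi_pow: "n \<le> length ((\<phi> ^^ n) [0])"
proof (induction n rule: induct_nat_012)
  case (ge2 n)
  have "(\<phi> ^^ n) [0] \<noteq> []" by (rule phi_pow_nonempty) auto
  then have "0 < length ((\<phi> ^^ n) [0])" by blast
  then show ?case using ge2(2) phi_pow_0_recurrence[of n] by (simp del: length_greater_0_conv)
qed simp_all

lemma fib_word_prefix: "prefix (length ((\<phi> ^^ n) [0])) fib_word = (\<phi> ^^ n) [0]"
  unfolding fib_word_def
proof (rule prefix_word_lim)
  show "\<exists>v. (\<phi> ^^ Suc n) [0] = (\<phi> ^^ n) [0] @ v" for n
    using phi_pow_0_recurrence[of "n - 1"] by (cases n) auto
qed (rule le_length_phi_pow)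

lemma fib_factor_iff_occurs: "fib_factor w \<longleftrightarrow> (\<exists>k. w = fib_word [k \<rightarrow> k + length w])"
proof
  assume "fib_factor w"
  then obtain n u v where n: "(\<phi> ^^ n) [0] = u @ w @ v" by (auto simp: fib_factor_def)
  have "w = take (length w) (drop (length u) (u @ w @ v))" by simp
  also have "\<dots> = take (length w) (drop (length u) (prefix (length (u @ w @ v)) fib_word))"
    using fib_word_prefix[of n] n by simp
  also have "\<dots> = fib_word [length u \<rightarrow> length u + length w]" by simp
  finally show "\<exists>k. w = fib_word [k \<rightarrow> k + length w]" by blast
next
  assume "\<exists>k. w = fib_word [k \<rightarrow> k + length w]"
  then obtain k where w: "w = fib_word [k \<rightarrow> k + length w]" by blast
  define n where "n = k + length w"
  have "n \<le> length ((\<phi> ^^ n) [0])" by (rule le_length_phi_pow)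
  then obtain r where r: "length ((\<phi> ^^ n) [0]) = n + r" using le_Suc_ex by blast
  have "(\<phi> ^^ n) [0] = prefix (n + r) fib_word" using fib_word_prefix[of n] r by simp
  also have "\<dots> = prefix k fib_word @ w @ fib_word [n \<rightarrow> n + r]"
    using subsequence_append[of fib_word n r] subsequence_append[of fib_word k "length w"] w
    by (simp add: n_def)
  finally show "fib_factor w" unfolding fib_factor_def by blast
qed

lemma shift_pow: "(shift ^^ k) x = suffix k x"
  by (induction k) (simp_all add: shift_def)

text \<open>
  Cylinders form a basis of the product topology, and a cylinder meets the orbit of the Fibonacci
  word exactly when its defining word is a factor. That the letters of \<open>x\<close> are 0 and 1 is implied
  by the right-hand side.
\<close>

lemma fib_subshift_iff: "x \<in> fib_subshift \<longleftrightarrow> (\<forall>n. fib_factor (prefix n x))"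
proof -
  let ?X = "product_topology (\<lambda>_ :: nat. discrete_topology {0, 1 :: nat}) UNIV"
  have topspace: "topspace ?X = {x. range x \<subseteq> {0, 1}}"
    by (simp add: PiE_UNIV_domain image_subset_iff Pi_def)
  have letters: "y i \<in> {0, 1}" if "fib_factor (prefix (Suc i) y)" for y i
    using fib_factor_in_lists[OF that] by (auto simp: subsequence_def)
  have closure: "x \<in> fib_subshift \<longleftrightarrow> x \<in> topspace ?X \<and>
      (\<forall>T. x \<in> T \<and> openin ?X T \<longrightarrow> (\<exists>k. (shift ^^ k) fib_word \<in> T))"
    unfolding fib_subshift_def in_closure_of by blast
  show ?thesis
  proof
    assume x: "x \<in> fib_subshift"
    show "\<forall>n. fib_factor (prefix n x)"
    proof
      fix n
      define T where "T = Pi\<^sub>E UNIV (\<lambda>i. if i < n then {x i} else {0, 1})"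
      have range: "range x \<subseteq> {0, 1}"
        using x unfolding closure topspace by simp
      then have "x \<in> T" by (auto simp: T_def PiE_def Pi_def)
      have "finite {i. (if i < n then {x i} else {0, 1}) \<noteq> {0, 1}}"
        by (rule finite_subset[of _ "{..<n}"]) auto
      then have "openin ?X T"
        unfolding T_def openin_PiE_gen using range by (simp add: image_subset_iff)
      then obtain k where k: "(shift ^^ k) fib_word \<in> T"
        using x \<open>x \<in> T\<close> unfolding closure by blast
      have "fib_word (k + i) = x i" if "i < n" for i
        using PiE_mem[OF k[unfolded T_def], of i] that by (simp add: shift_pow suffix_def)
      then have "prefix n x = fib_word [k \<rightarrow> k + n]" by (intro nth_equalityI) auto
      then show "fib_factor (prefix n x)" unfolding fib_factor_iff_occurs by auto
    qed
  next
    assume x: "\<forall>n. fib_factor (prefix n x)"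
    have "\<exists>k. (shift ^^ k) fib_word \<in> T" if "x \<in> T" "openin ?X T" for T
    proof -
      obtain U where U: "finite {i. U i \<noteq> {0, 1}}" "x \<in> Pi\<^sub>E UNIV U" "Pi\<^sub>E UNIV U \<subseteq> T"
        using \<open>openin ?X T\<close> \<open>x \<in> T\<close> unfolding openin_product_topology_alt by auto
      obtain n where n: "U i = {0, 1}" if "i \<ge> n" for i
        using U(1) unfolding finite_nat_set_iff_bounded
        by (metis (mono_tags, lifting) leD mem_Collect_eq)
      obtain k where k: "prefix n x = fib_word [k \<rightarrow> k + n]"
        using x[rule_format, of n] unfolding fib_factor_iff_occurs by auto
      have fib: "fib_word i \<in> {0, 1}" for i
        by (rule letters) (auto simp: fib_factor_iff_occurs intro: exI[of _ 0])
      have "fib_word (k + i) \<in> U i" for i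
      proof (cases "i < n")
        case True
        then have "fib_word (k + i) = x i"
          using arg_cong[OF k, of "\<lambda>w. w ! i"] by simp
        then show ?thesis using U(2) by auto
      qed (use n[of i] fib in auto)
      then have "(shift ^^ k) fib_word \<in> T"
        using U(3) by (auto simp: shift_pow)
      then show ?thesis by blast
    qed
    moreover have "x \<in> topspace ?X" 
      using letters[OF x[rule_format]] unfolding topspace by (simp add: image_subset_iff)
    ultimately show "x \<in> fib_subshift" unfolding closure by blast
  qed
qed

text \<open>
  As factors are closed under taking prefixes, it suffices to test arbitrarily long prefixes.
\<close>

lemma word_lim_in_fib_subshift_iff:
  assumes extends: "\<And>n. \<exists>v. u (Suc n) = u n @ v" and long: "\<And>n. n \<le> length (u n)"
  shows "word_lim u \<in> fib_subshift \<longleftrightarrow> (\<forall>n. fib_factor (u n))"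
proof -
  have eq: "prefix (length (u n)) (word_lim u) = u n" for n
    using assms by (rule prefix_word_lim)
  show ?thesis unfolding fib_subshift_iff
  proof safe
    fix n assume "\<forall>n. fib_factor (prefix n (word_lim u))"
    then show "fib_factor (u n)" using eq by metis
  next
    fix n assume "\<forall>n. fib_factor (u n)"
    then have "fib_factor (prefix (n + (length (u n) - n)) (word_lim u))"
      using eq[of n] long[of n] by simp
    then show "fib_factor (prefix n (word_lim u))"
      unfolding subsequence_append by (rule fib_factor_appendD1)
  qed
qed

section \<open>Expansions as labels of walks\<close>

definition expansion_prefix :: "nat word \<Rightarrow> nat \<Rightarrow> nat list" where
  "expansion_prefix s n = concat (map (\<lambda>i. (\<phi> ^^ i) (c_suf (s i))) [0..<n])"

lemma expansion_prefix_0 [simp]: "expansion_prefix s 0 = []"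
  by (simp add: expansion_prefix_def)

lemma expansion_prefix_snoc:
  "expansion_prefix s (Suc n) = expansion_prefix s n @ (\<phi> ^^ n) (c_suf (s n))"
  by (simp add: expansion_prefix_def)

lemma expansion_prefix_Suc:
  "expansion_prefix s (Suc n) = c_suf (s 0) @ \<phi> (expansion_prefix (shift s) n)"
  by (induction n) (simp_all add: expansion_prefix_snoc shift_def suffix_def)

lemma c_suf_letters:
  assumes "a \<in> {0, 1, 2}"
  shows "c_suf a \<in> lists {0, 1}" "c_suf a \<noteq> []"
  using assms by (auto simp: c_suf_def)

lemma expansion_prefix_in_lists:
  assumes "range s \<subseteq> {0, 1, 2}"
  shows "expansion_prefix s n \<in> lists {0, 1}"
proof (induction n)
  case (Suc n)
  have "(\<phi> ^^ n) (c_suf (s n)) \<in> lists {0, 1}"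
    by (intro phi_pow_in_lists c_suf_letters range_subsetD[OF assms])
  then show ?case using Suc unfolding expansion_prefix_snoc by simp
qed simp

lemma suffix_expansion_in_fib_subshift_iff:
  assumes "range s \<subseteq> {0, 1, 2}"
  shows "suffix_expansion s \<in> fib_subshift \<longleftrightarrow> (\<forall>n. fib_factor (expansion_prefix s n))"
proof -
  have "n \<le> length (expansion_prefix s n)" for n
  proof (induction n)
    case (Suc n)
    have "s n \<in> {0, 1, 2}" by (rule range_subsetD[OF assms])
    then have "(\<phi> ^^ n) (c_suf (s n)) \<noteq> []" by (intro phi_pow_nonempty c_suf_letters)
    then have "0 < length ((\<phi> ^^ n) (c_suf (s n)))" by blast
    then show ?case using Suc unfolding expansion_prefix_snoc length_append by linarith
  qed simp
  moreover have "suffix_expansion s = word_lim (expansion_prefix s)"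
    unfolding suffix_expansion_def expansion_prefix_def ..
  ultimately show ?thesis
    using word_lim_in_fib_subshift_iff[of "expansion_prefix s"] expansion_prefix_snoc by metis
qed

text \<open>
  Expresses that \<open>u\<close> followed by the expansion of \<open>s\<close> belongs to the Fibonacci subshift.
\<close>

definition left_admissible :: "nat list \<Rightarrow> nat word \<Rightarrow> bool" where
  "left_admissible u s \<longleftrightarrow> (\<forall>n. fib_factor (u @ expansion_prefix s n))"

lemma left_admissible_drop: "left_admissible (u @ v) s \<Longrightarrow> left_admissible v s"
  unfolding left_admissible_def using fib_factor_appendD2[of u] by simp

lemma fib_factor_1_extends_by_0:
  assumes "fib_factor (1 # w)"
  shows "fib_factor (0 # 1 # w)"
proof -
  obtain a where a: "a \<in> {0, 1}" "fib_factor (a # 1 # w)"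
    using fib_factor_left_extension[OF assms] .
  then show ?thesis using fib_factor_appendD1[of "[1, 1]" w] not_fib_factor_11 by auto
qed

lemma left_admissible_1: "left_admissible (1 # u) s \<Longrightarrow> left_admissible (0 # 1 # u) s"
  unfolding left_admissible_def using fib_factor_1_extends_by_0 by simp

text \<open>
  If \<open>u c(s\<^sub>0) = \<phi>(v)\<close>, then \<open>u \<pi>(s) = \<phi>(v \<pi>(T s))\<close>.
\<close>

lemma left_admissible_desubstitute:
  assumes "left_admissible u s" "range s \<subseteq> {0, 1, 2}"
    and v: "v \<in> lists {0, 1}" "\<phi> v = u @ c_suf (s 0)"
  shows "left_admissible v (shift s)"
  unfolding left_admissible_def
proof
  fix n
  let ?p = "expansion_prefix (shift s)"
  have s: "range (shift s) \<subseteq> {0, 1, 2}"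
    using assms(2) by (simp add: image_subset_iff shift_def suffix_def)
  then have "shift s n \<in> {0, 1, 2}" by (rule range_subsetD)
  note c = c_suf_letters[OF this]
  obtain y where y: "\<phi> ((\<phi> ^^ n) (c_suf (shift s n))) = 0 # y"
    using phi_nonempty_starts_with_0[OF phi_pow_in_lists phi_pow_nonempty] c by blast
  \<comment> \<open>One further factor of the expansion supplies the 0 that desubstitution requires.\<close>
  have "fib_factor (u @ expansion_prefix s (Suc (Suc n)))"
    using assms(1) by (simp add: left_admissible_def)
  also have "u @ expansion_prefix s (Suc (Suc n)) = (\<phi> (v @ ?p n) @ [0]) @ y"
    unfolding expansion_prefix_Suc[of s "Suc n"] expansion_prefix_snoc[of "shift s"] phi_append y
      v(2) by simp
  finally have "fib_factor (\<phi> (v @ ?p n) @ [0])" by (rule fib_factor_appendD1)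
  then show "fib_factor (v @ ?p n)"
    by (rule fib_factor_desubstitute)
      (use v(1) expansion_prefix_in_lists[OF s, of n] in \<open>simp add: append_in_lists_conv\<close>)
qed

text \<open>
  Every left-infinite word over \<open>{0, 1}\<close> ends with exactly one of these words.
\<close>

fun left_context :: "vertex \<Rightarrow> nat list" where
  "left_context q1 = [1]"
| "left_context q3 = [0, 0]"
| "left_context q4 = [1, 0]"

text \<open>
  For every edge, \<open>left_context q @ c_suf a\<close> is a suffix of \<open>\<phi> (left_context q')\<close>, possibly
  after prepending 0 to a context that begins with 1.
\<close>

lemma fib_factor_along_edge:
  assumes "(q, a, q') \<in> fib_graph" "fib_factor (left_context q' @ w)"
  shows "fib_factor (left_context q @ c_suf a @ \<phi> w)"
proof -
  have phi_01: "fib_factor (\<phi> (0 # 1 # u))" if "fib_factor (1 # u)" for u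
    using that by (intro fib_factor_phi fib_factor_1_extends_by_0)
  consider "q = q1" "a = 0" "q' = q1" | "q = q1" "a = 2" "q' = q3" | "q = q3" "a = 1" "q' = q4"
    | "q = q4" "a = 1" "q' = q3" | "q = q4" "a = 2" "q' = q4"
    using assms(1) by (auto simp: fib_graph_def)
  then show ?thesis
  proof cases
    case 1
    then show ?thesis
      using assms(2) phi_01[of w] fib_factor_appendD2[of "[0]" "1 # 0 # \<phi> w"]
      by (simp add: c_suf_def)
  next
    case 2
    then show ?thesis
      using fib_factor_phi[OF assms(2)] fib_factor_appendD2[of "[0]" "1 # 0 # 1 # \<phi> w"]
      by (simp add: c_suf_def)
  next
    case 3
    then show ?thesis using fib_factor_phi[OF assms(2)] by (simp add: c_suf_def)
  next
    case 4
    then show ?thesis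
      using fib_factor_phi[OF assms(2)] fib_factor_appendD2[of "[0]" "1 # 0 # 1 # \<phi> w"]
      by (simp add: c_suf_def)
  next
    case 5
    then show ?thesis
      using assms(2) phi_01[of "0 # w"]
        fib_factor_appendD2[of "[0]" "1 # 0 # 0 # 1 # \<phi> w"] by (simp add: c_suf_def)
  qed
qed

lemma fib_graph_edge_iff:
  "(q, a, q') \<in> fib_graph \<longleftrightarrow> q = q1 \<and> a = 0 \<and> q' = q1 \<or> q = q1 \<and> a = 2 \<and> q' = q3 \<or>
    q = q3 \<and> a = 1 \<and> q' = q4 \<or> q = q4 \<and> a = 1 \<and> q' = q3 \<or> q = q4 \<and> a = 2 \<and> q' = q4"
  by (auto simp: fib_graph_def)

text \<open>
  The case distinction that produces the graph: a pair of a vertex and a letter without edge yields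
  the forbidden factor 11 or 000, and otherwise the left context, preceded by 0 if it begins
  with 1, can be desubstituted.
\<close>

lemma left_admissible_step:
  assumes adm: "left_admissible (left_context q) s" and s: "range s \<subseteq> {0, 1, 2}"
  shows "\<exists>q'. (q, s 0, q') \<in> fib_graph \<and> left_admissible (left_context q') (shift s)"
proof -
  have letters: "s i = 0 \<or> s i = 1 \<or> s i = 2" for i
    using range_subsetD[OF s, of i] by simp
  have not: False if "left_context q @ expansion_prefix s n = x @ z @ y" "\<not> fib_factor z" for n x y z
    using adm that fib_factor_infix[of x z y] unfolding left_admissible_def by metis
  have one: "left_context q @ expansion_prefix s 1 = left_context q @ c_suf (s 0)"
    by (simp add: expansion_prefix_Suc[of s 0, simplified])
  \<comment> \<open>Past \<open>c_suf (s 0)\<close> the expansion continues with an image under \<open>\<phi>\<close>, hence with 0; this third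
    0 excludes the letter 0 at \<open>q4\<close>.\<close>
  obtain y where two: "left_context q @ expansion_prefix s (Suc 1) = left_context q @ c_suf (s 0) @ 0 # y"
  proof -
    have "shift s 0 \<in> {0, 1, 2}" using letters[of 1] by (simp add: shift_def suffix_def)
    note c = c_suf_letters[OF this]
    show thesis
      using phi_nonempty_starts_with_0[OF c] that
      by (auto simp: expansion_prefix_Suc[of s] expansion_prefix_Suc[of "shift s"])
  qed
  have desubstitute: "left_admissible v (shift s)"
    if "left_admissible (u @ left_context q) s" "v \<in> lists {0, 1}" "\<phi> v = u @ left_context q @ c_suf (s 0)"
    for u v
    using left_admissible_desubstitute[OF that(1) s that(2)] that(3) by simp
  have drop: "left_admissible u t" if "left_admissible (0 # u) t" for u t
    using left_admissible_drop[of "[0]" u t] that by simp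
  show ?thesis
  proof (cases q)
    case q1
    have adm': "left_admissible ([0] @ left_context q) s"
      using left_admissible_1[of "[]"] adm q1 by simp
    consider "s 0 = 0" | "s 0 = 1" | "s 0 = 2" using letters[of 0] by argo
    then show ?thesis
    proof cases
      case 1
      then have "left_admissible [0, 1] (shift s)"
        using q1 by (intro desubstitute[OF adm']) (simp_all add: c_suf_def)
      then show ?thesis using drop[of "[1]"] q1 1 by (auto simp: fib_graph_def intro: exI[of _ q1])
    next
      case 2
      then show ?thesis
        using not[of 1 "[]" "[1, 1]" "[]"] one q1 not_fib_factor_11 by (simp add: c_suf_def)
    next
      case 3
      then have "left_admissible [0, 0] (shift s)"
        using q1 by (intro desubstitute[OF adm']) (simp_all add: c_suf_def)
      then show ?thesis using q1 3 by (auto simp: fib_graph_def intro: exI[of _ q3])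
    qed
  next
    case q3
    consider "s 0 = 0" | "s 0 = 1" | "s 0 = 2" using letters[of 0] by argo
    then show ?thesis
    proof cases
      case 1
      then show ?thesis
        using not[of 1 "[]" "[0, 0, 0]" "[]"] one q3 not_fib_factor_000 by (simp add: c_suf_def)
    next
      case 2
      then have "left_admissible [1, 0] (shift s)"
        using q3 adm by (intro desubstitute[of "[]"]) (simp_all add: c_suf_def)
      then show ?thesis using q3 2 by (auto simp: fib_graph_def intro: exI[of _ q4])
    next
      case 3
      then show ?thesis
        using not[of 1 "[]" "[0, 0, 0]" "[1]"] one q3 not_fib_factor_000 by (simp add: c_suf_def)
    qed
  next
    case q4
    have adm': "left_admissible ([0] @ left_context q) s"
      using left_admissible_1[of "[0]"] adm q4 by simp
    consider "s 0 = 0" | "s 0 = 1" | "s 0 = 2" using letters[of 0] by argo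
    then show ?thesis
    proof cases
      case 1
      then show ?thesis
        using not[of "Suc 1" "[1]" "[0, 0, 0]" y] two q4 not_fib_factor_000 by (simp add: c_suf_def)
    next
      case 2
      then have "left_admissible [0, 0] (shift s)"
        using q4 by (intro desubstitute[OF adm']) (simp_all add: c_suf_def)
      then show ?thesis using q4 2 by (auto simp: fib_graph_def intro: exI[of _ q3])
    next
      case 3
      then have "left_admissible [0, 1, 0] (shift s)"
        using q4 by (intro desubstitute[OF adm']) (simp_all add: c_suf_def)
      then show ?thesis
        using drop[of "[1, 0]"] q4 3 by (auto simp: fib_graph_def intro: exI[of _ q4])
    qed
  qed
qed

text \<open>
  Each finite prefix extends to the left by one of the three contexts. The same context works for
  all of them, since there are finitely many contexts and a failure persists for longer prefixes.
\<close>

lemma left_admissible_context: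
  assumes "left_admissible [] s"
  obtains q where "left_admissible (left_context q) s"
proof (rule ccontr)
  assume "\<not> thesis"
  then have "\<forall>q. \<exists>n. \<not> fib_factor (left_context q @ expansion_prefix s n)"
    using that by (auto simp: left_admissible_def)
  then obtain n where n: "\<not> fib_factor (left_context q @ expansion_prefix s (n q))" for q
    by metis
  have mono: "fib_factor (u @ expansion_prefix s m)"
    if "m \<le> n" "fib_factor (u @ expansion_prefix s n)" for u m n
    using that
  proof (induction n rule: dec_induct)
    case (step n)
    then show ?case
      using fib_factor_appendD1[of "u @ expansion_prefix s n"] by (simp add: expansion_prefix_snoc)
  qed
  define N where "N = max (n q1) (max (n q3) (n q4))"
  have "n q \<le> N" for q by (cases q) (simp_all add: N_def)
  then have no: "\<not> fib_factor (left_context q @ expansion_prefix s N)" for q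
    using n mono by blast
  have "fib_factor (expansion_prefix s N)" using assms by (simp add: left_admissible_def)
  then obtain a where a: "a \<in> {0, 1}" "fib_factor (a # expansion_prefix s N)"
    by (rule fib_factor_left_extension)
  then have a0: "fib_factor (0 # expansion_prefix s N)" using no[of q1] by auto
  obtain b where "b \<in> {0, 1}" "fib_factor (b # 0 # expansion_prefix s N)"
    using fib_factor_left_extension[OF a0] .
  then show False using no[of q3] no[of q4] by auto
qed

definition walk_from :: "('q \<times> 'a \<times> 'q) set \<Rightarrow> 'q \<Rightarrow> 'a word \<Rightarrow> bool" where
  "walk_from E q s \<longleftrightarrow> (\<exists>p. p 0 = q \<and> (\<forall>i. (p i, s i, p (Suc i)) \<in> E))"

lemma infinite_walk_label_iff: "infinite_walk_label E s \<longleftrightarrow> (\<exists>q. walk_from E q s)"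
  by (auto simp: infinite_walk_label_def walk_from_def)

lemma walk_from_step:
  "walk_from E q s \<longleftrightarrow> (\<exists>q'. (q, s 0, q') \<in> E \<and> walk_from E q' (shift s))"
proof
  assume "walk_from E q s"
  then obtain p where "p 0 = q" "\<And>i. (p i, s i, p (Suc i)) \<in> E" by (auto simp: walk_from_def)
  then have "(q, s 0, p 1) \<in> E \<and> walk_from E (p 1) (shift s)"
    unfolding walk_from_def shift_def suffix_def
    by (auto intro!: exI[of _ "\<lambda>i. p (Suc i)"])
  then show "\<exists>q'. (q, s 0, q') \<in> E \<and> walk_from E q' (shift s)" by blast
next
  assume "\<exists>q'. (q, s 0, q') \<in> E \<and> walk_from E q' (shift s)"
  then obtain p where p: "(q, s 0, p 0) \<in> E" "\<And>i. (p i, s (Suc i), p (Suc i)) \<in> E"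
    by (auto simp: walk_from_def shift_def suffix_def)
  then have "(case_nat q p i, s i, case_nat q p (Suc i)) \<in> E" for i by (cases i) auto
  then show "walk_from E q s" unfolding walk_from_def by (intro exI[of _ "case_nat q p"]) simp
qed

lemma walk_from_build: "walk_from E q (a ## s) \<longleftrightarrow> (\<exists>q'. (q, a, q') \<in> E \<and> walk_from E q' s)"
proof -
  have "shift (a ## s) = s" by (simp add: shift_def suffix_def)
  then show ?thesis using walk_from_step[of E q "a ## s"] by simp
qed

text \<open>
  From left to right, each prefix is built from the end of a finite part of the walk, starting with a
  context alone; from right to left, the walk is found step by step.
\<close>

lemma walk_from_iff_left_admissible:
  assumes s: "range s \<subseteq> {0, 1, 2}"
  shows "walk_from fib_graph q s \<longleftrightarrow> left_admissible (left_context q) s"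
proof
  have "fib_factor (left_context q @ expansion_prefix s n)" if "walk_from fib_graph q s" for n
    using that
  proof (induction n arbitrary: q s)
    case 0
    have "fib_factor [0, 1, 0, 0, 1]"
      unfolding fib_factor_def
      by (rule exI[of _ 4], rule exI[of _ "[]"], rule exI[of _ "[0, 1, 0]"])
        (simp add: eval_nat_numeral)
    then have "fib_factor (left_context q)"
      using fib_factor_infix[of "[0]" "[1]" "[0, 0, 1]"]
        fib_factor_infix[of "[0, 1]" "[0, 0]" "[1]"] fib_factor_infix[of "[0]" "[1, 0]" "[0, 1]"]
      by (cases q) simp_all
    then show ?case by simp
  next
    case (Suc n)
    then obtain q' where "(q, s 0, q') \<in> fib_graph" "walk_from fib_graph q' (shift s)"
      using walk_from_step by metis
    then show ?case
      using fib_factor_along_edge Suc.IH unfolding expansion_prefix_Suc by blast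
  qed
  then show "left_admissible (left_context q) s" if "walk_from fib_graph q s"
    using that by (simp add: left_admissible_def)
next
  assume adm: "left_admissible (left_context q) s"
  have "\<exists>p. \<forall>i. (left_admissible (left_context (p i)) (suffix i s) \<and> (i = 0 \<longrightarrow> p i = q)) \<and>
      (p i, s i, p (Suc i)) \<in> fib_graph"
  proof (rule dependent_nat_choice[where
        P = "\<lambda>i q'. left_admissible (left_context q') (suffix i s) \<and> (i = 0 \<longrightarrow> q' = q)" and
        Q = "\<lambda>i q' q''. (q', s i, q'') \<in> fib_graph"])
    show "\<exists>q'. left_admissible (left_context q') (suffix 0 s) \<and> (0 = (0 :: nat) \<longrightarrow> q' = q)"
      using adm by simp
  next
    fix q' and i :: nat
    assume "left_admissible (left_context q') (suffix i s) \<and> (i = 0 \<longrightarrow> q' = q)"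
    moreover have "range (suffix i s) \<subseteq> {0, 1, 2}"
      using s by (simp add: image_subset_iff suffix_def)
    ultimately show "\<exists>q''. (left_admissible (left_context q'') (suffix (Suc i) s) \<and>
        (Suc i = 0 \<longrightarrow> q'' = q)) \<and> (q', s i, q'') \<in> fib_graph"
      using left_admissible_step[of q' "suffix i s"] by (auto simp: shift_def suffix_def)
  qed
  then show "walk_from fib_graph q s" unfolding walk_from_def by metis
qed

lemma walk_from_fib_graph_letters: "walk_from fib_graph q s \<Longrightarrow> range s \<subseteq> {0, 1, 2}"
  unfolding walk_from_def fib_graph_def image_subset_iff by blast

lemma S_fib_iff: "s \<in> S_fib \<longleftrightarrow> (\<exists>q. walk_from fib_graph q s)"
proof (cases "range s \<subseteq> {0, 1, 2}")
  case True
  then have "s \<in> S_fib \<longleftrightarrow> left_admissible [] s"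
    by (simp add: S_fib_def left_admissible_def suffix_expansion_in_fib_subshift_iff)
  also have "\<dots> \<longleftrightarrow> (\<exists>q. left_admissible (left_context q) s)"
    using left_admissible_context left_admissible_drop[of _ "[]"] by (metis append_Nil2)
  finally show ?thesis using walk_from_iff_left_admissible[OF True] by simp
next
  case False
  then have "s \<notin> S_fib" by (simp add: S_fib_def)
  moreover have "\<not> walk_from fib_graph q s" for q using walk_from_fib_graph_letters False by metis
  ultimately show ?thesis by simp
qed

section \<open>Regularity of the language\<close>

definition successors :: "('q \<times> 'a \<times> 'q) set \<Rightarrow> 'q set \<Rightarrow> 'a \<Rightarrow> 'q set" where
  "successors E A a = {q'. \<exists>q\<in>A. (q, a, q') \<in> E}"

text \<open>
  The subset construction with every vertex initial; a word labels a walk as long as the set of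
  reachable vertices is nonempty. The injection \<open>h\<close> encodes these sets as the numbers that
  serve as states.
\<close>

lemma regular_language_walk_labels:
  fixes E :: "('q :: finite \<times> 'a \<times> 'q) set"
  assumes "finite A"
  shows "regular_language A {w \<in> lists A. foldl (successors E) UNIV w \<noteq> {}}"
proof -
  have "finite (UNIV :: 'q set set)" by (rule finite)
  from finite_imp_inj_to_nat_seg[OF this] obtain h :: "'q set \<Rightarrow> nat" where h: "inj h"
    by (elim exE conjE)
  define \<delta> where "\<delta> n a = h (successors E (inv h n) a)" for n a
  have "foldl \<delta> (h B) w = h (foldl (successors E) B w)" for B w
    by (induction w arbitrary: B) (simp_all add: \<delta>_def h)
  then have "{w \<in> lists A. foldl (successors E) UNIV w \<noteq> {}} =
      {w \<in> lists A. foldl \<delta> (h UNIV) w \<in> h ` {B. B \<noteq> {}}}"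
    using h by (auto simp: inj_image_mem_iff)
  moreover have "finite (range h)" by simp
  ultimately show ?thesis
    unfolding regular_language_def using assms
    by (intro conjI exI[of _ "range h"] exI[of _ \<delta>] exI[of _ "h UNIV"]
        exI[of _ "h ` {B. B \<noteq> {}}"]) (auto simp: \<delta>_def)
qed

lemma walk_label_factor_successors:
  fixes p :: "nat \<Rightarrow> 'q" and s :: "'a word" and i j :: nat
  assumes p: "\<And>i. (p i, s i, p (Suc i)) \<in> E" and "i \<le> j"
  shows "p j \<in> foldl (successors E) UNIV (s [i \<rightarrow> j])"
  using \<open>i \<le> j\<close>
proof (induction j rule: dec_induct)
  case (step j)
  then have "s [i \<rightarrow> Suc j] = s [i \<rightarrow> j] @ [s j]" by (simp add: subsequence_def)
  then show ?case using step p[of j] by (auto simp: successors_def)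
qed simp

lemma walk_from_append:
  assumes "q' \<in> foldl (successors E) A w" "walk_from E q' z"
  obtains q where "q \<in> A" "walk_from E q (w \<frown> z)"
proof -
  have "\<exists>q\<in>A. walk_from E q (w \<frown> z)"
    using assms(1)
  proof (induction w arbitrary: A)
    case Nil
    then show ?case using assms(2) by auto
  next
    case (Cons a w)
    then obtain q1 where q1: "q1 \<in> successors E A a" "walk_from E q1 (w \<frown> z)" by auto
    then show ?case by (auto simp: successors_def walk_from_build)
  qed
  then show thesis using that by blast
qed

text \<open>
  The walks labelled \<open>0\<^sup>\<omega>\<close> from \<open>q1\<close> and \<open>1\<^sup>\<omega>\<close> from \<open>q3\<close> and \<open>q4\<close>.
\<close>

lemma fib_graph_walk_exists: "\<exists>z. walk_from fib_graph q z"
proof (cases "q = q1")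
  case True
  then have "walk_from fib_graph q (\<lambda>_. 0)"
    unfolding walk_from_def by (intro exI[of _ "\<lambda>_. q1"]) (simp add: fib_graph_edge_iff)
  then show ?thesis by blast
next
  case False
  let ?swap = "\<lambda>q. if q = q3 then q4 else q3"
  have swap: "(?swap ^^ i) q \<noteq> q1" for i by (induction i) (use False in auto)
  have "((?swap ^^ i) q, 1, (?swap ^^ Suc i) q) \<in> fib_graph" for i
    using swap[of i] by (cases "(?swap ^^ i) q") (auto simp: fib_graph_edge_iff)
  then have "walk_from fib_graph q (\<lambda>_. 1)"
    unfolding walk_from_def by (intro exI[of _ "\<lambda>i. (?swap ^^ i) q"]) simp
  then show ?thesis by blast
qed

instance vertex :: finite
proof
  have "(UNIV :: vertex set) = {q1, q3, q4}" using vertex.exhaust by blast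
  then show "finite (UNIV :: vertex set)" by (metis finite.emptyI finite.insertI)
qed

lemma factors_S_fib:
  "factors S_fib = {w \<in> lists {0, 1, 2}. foldl (successors fib_graph) UNIV w \<noteq> {}}"
proof (intro equalityI subsetI)
  fix w assume "w \<in> factors S_fib"
  then obtain s :: "nat word" and i j :: nat where s: "s \<in> S_fib" and w: "w = s [i \<rightarrow> j]"
    by (auto simp: factors_def)
  obtain q p where p: "\<And>i. (p i, s i, p (Suc i)) \<in> fib_graph"
    using s unfolding S_fib_iff walk_from_def by blast
  have "range s \<subseteq> {0, 1, 2}" using s by (simp add: S_fib_def)
  then have "w \<in> lists {0, 1, 2}" unfolding w by (simp add: in_lists_conv_set image_subset_iff)
  moreover have "foldl (successors fib_graph) UNIV w \<noteq> {}"
    using walk_label_factor_successors[of p s fib_graph, OF p, of i j] w by (cases "i \<le> j") auto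
  ultimately show "w \<in> {w \<in> lists {0, 1, 2}. foldl (successors fib_graph) UNIV w \<noteq> {}}" by blast
next
  fix w assume "w \<in> {w \<in> lists {0, 1, 2}. foldl (successors fib_graph) UNIV w \<noteq> {}}"
  then obtain q' where q': "q' \<in> foldl (successors fib_graph) UNIV w" by blast
  obtain z where "walk_from fib_graph q' z" using fib_graph_walk_exists by blast
  then obtain q where "walk_from fib_graph q (w \<frown> z)" using walk_from_append q' by metis
  then have "w \<frown> z \<in> S_fib" unfolding S_fib_iff by blast
  moreover have "w = (w \<frown> z) [0 \<rightarrow> length w]" by simp
  ultimately show "w \<in> factors S_fib" unfolding factors_def by blast
qed

section \<open>The action of the suffix conjugate\<close>

lemma c_suf_inv_c_suf [simp]: "a \<in> {0, 1, 2} \<Longrightarrow> c_suf_inv (c_suf a) = a"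
  unfolding c_suf_inv_def by (rule the_inv_into_f_f[OF inj_on_c_suf])

lemma c_suf_inv_simps [simp]:
  "c_suf_inv [0] = 0" "c_suf_inv [Suc 0] = 1" "c_suf_inv [0, Suc 0] = 2"
  using c_suf_inv_c_suf[of 0] c_suf_inv_c_suf[of 1] c_suf_inv_c_suf[of 2]
  by (simp_all add: c_suf_def)

lemma two_letters_iff: "length (c_suf a) \<ge> 2 \<longleftrightarrow> a = 2"
  by (simp add: c_suf_def)

lemma letter_image: "a \<in> {0, 1} \<Longrightarrow> [c_suf_inv (\<phi> (c_suf a))] = lam a"
  by (auto simp: c_suf_def lam_def)

lemma morph_append: "morph h (u @ v) = morph h u @ morph h v"
  by (simp add: morph_def)

lemma morph_lam_letters:
  assumes "x \<in> lists {0, 1}"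
  shows "morph lam x = map (\<lambda>a. c_suf_inv (\<phi> (c_suf a))) x"
  using assms by (induction x) (simp_all add: morph_def letter_image[symmetric])

lemma H_fib_2: "H_fib ([2] \<frown> z) = [1] \<frown> z"
proof -
  let ?s = "[2] \<frown> z"
  have "(LEAST r. length (c_suf (?s r)) \<ge> 2) = 0" by (rule Least_eq_0) (simp add: c_suf_def)
  moreover have "\<exists>r. length (c_suf (?s r)) \<ge> 2" by (rule exI[of _ 0]) (simp add: c_suf_def)
  ultimately show ?thesis
    by (auto simp: fun_eq_iff H_fib_def G_fib_def shift_def suffix_def c_suf_def conc_def)
qed

lemma H_fib_letters_2:
  assumes a: "a \<in> {0, 1}" and x: "x \<in> lists {0, 1}"
  shows "H_fib (([a] @ x @ [2]) \<frown> z) = morph lam (x @ [2]) \<frown> z"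
proof -
  let ?s = "([a] @ x @ [2]) \<frown> z"
  define r where "r = Suc (length x)"
  have sr: "?s r = 2" by (simp add: r_def nth_append)
  have s_less: "?s i \<in> {0, 1}" if "i < r" for i
  proof -
    have "?s i = (a # x) ! i" using that by (simp add: r_def nth_append nth_Cons split: nat.split)
    also have "\<dots> \<in> set (a # x)" using that by (intro nth_mem) (simp add: r_def)
    finally show ?thesis using a x by auto
  qed
  have ex: "\<exists>r. length (c_suf (?s r)) \<ge> 2" unfolding two_letters_iff using sr by blast
  have least: "(LEAST r. length (c_suf (?s r)) \<ge> 2) = r"
    unfolding two_letters_iff
  proof (rule Least_equality)
    show "?s r = 2" by (rule sr)
    show "r \<le> i" if "?s i = 2" for i using s_less[of i] that by (cases "i < r") auto
  qed
  show ?thesis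
  proof
    fix i
    have lam: "morph lam (x @ [2]) = map (\<lambda>a. c_suf_inv (\<phi> (c_suf a))) x @ [2, 1]"
      unfolding morph_append morph_lam_letters[OF x] by (simp add: morph_def lam_def)
    have G: "H_fib ?s i = (if Suc i < r then c_suf_inv (\<phi> (c_suf (?s (Suc i))))
        else if Suc i = r then 2 else if i = r then 1 else ?s i)"
      unfolding H_fib_def G_fib_def shift_def suffix_def Let_def least sr if_P[OF ex]
      by (simp add: c_suf_def)
    consider "Suc i < r" | "Suc i = r" | "i = r" | "i > r" by linarith
    then show "H_fib ?s i = (morph lam (x @ [2]) \<frown> z) i"
      unfolding G lam by cases (simp_all add: r_def nth_append conc_def)
  qed
qed

lemma H_fib_letters:
  assumes a: "a \<in> {0, 1}" and z: "range z \<subseteq> {0, 1}"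
  shows "H_fib ([a] \<frown> z) = (\<lambda>i. c_suf_inv (\<phi> (c_suf (z i))))"
proof -
  have "([a] \<frown> z) i \<noteq> 2" for i
    using a range_subsetD[OF z, of "i - 1"] by (auto simp: conc_def)
  then have "\<not> (\<exists>r. length (c_suf (([a] \<frown> z) r)) \<ge> 2)" unfolding two_letters_iff by blast
  then show ?thesis
    unfolding H_fib_def G_fib_def shift_def suffix_def by (simp add: conc_def)
qed

lemma morph_inf_lam_letters:
  assumes z: "range z \<subseteq> {0, 1}"
  shows "morph_inf lam z = (\<lambda>i. c_suf_inv (\<phi> (c_suf (z i))))"
  unfolding morph_inf_def
proof (rule word_lim_eqI)
  fix i
  have "prefix n z \<in> lists {0, 1}" for n
    using z by (simp add: in_lists_conv_set image_subset_iff)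
  then have "i < length (morph lam (prefix n z)) \<and>
      morph lam (prefix n z) ! i = c_suf_inv (\<phi> (c_suf (z i)))" if "n \<ge> Suc i" for n
    using that morph_lam_letters[of "prefix n z"] by simp
  then show "\<forall>\<^sub>F n in sequentially. i < length (morph lam (prefix n z)) \<and>
      morph lam (prefix n z) ! i = c_suf_inv (\<phi> (c_suf (z i)))"
    unfolding eventually_sequentially by blast
qed

text \<open>
  On the letters 0 and 1, a walk either stays at \<open>q1\<close> reading zeros or alternates between \<open>q3\<close> and
  \<open>q4\<close> reading ones. Under \<open>\<lambda>\<close> the former becomes a loop of twos at \<open>q4\<close> and the latter a loop of
  zeros at \<open>q1\<close>. The final 21 leads to the vertex that the letter 2 led to in the given walk:
  from \<open>q4\<close> to \<open>q3\<close>, or from \<open>q1\<close> to \<open>q4\<close>.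
\<close>

lemma walk_from_lam:
  assumes "walk_from fib_graph q ((x @ [2]) \<frown> z)" "x \<in> lists {0, 1}"
  shows "walk_from fib_graph (if q = q1 then q4 else q1) (morph lam (x @ [2]) \<frown> z)"
  using assms
proof (induction x arbitrary: q)
  case Nil
  then have "q = q1 \<and> walk_from fib_graph q3 z \<or> q = q4 \<and> walk_from fib_graph q4 z"
    by (auto simp: walk_from_build fib_graph_edge_iff)
  then show ?case by (auto simp: morph_def lam_def walk_from_build fib_graph_edge_iff)
next
  case (Cons a x)
  obtain q' where q': "(q, a, q') \<in> fib_graph" "walk_from fib_graph q' ((x @ [2]) \<frown> z)"
    using Cons.prems(1) by (auto simp: walk_from_build)
  have "walk_from fib_graph (if q' = q1 then q4 else q1) (morph lam (x @ [2]) \<frown> z)"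
    using Cons.IH[OF q'(2)] Cons.prems(2) by simp
  moreover have "a = 0 \<and> q = q1 \<and> q' = q1 \<or> a = 1 \<and> q \<noteq> q1 \<and> q' \<noteq> q1"
    using q'(1) Cons.prems(2) by (auto simp: fib_graph_edge_iff)
  moreover have "morph lam ((a # x) @ [2]) = lam a @ morph lam (x @ [2])" by (simp add: morph_def)
  moreover have "lam 0 = [2]" "lam 1 = [0]" by (simp_all add: lam_def)
  ultimately show ?case by (auto simp: walk_from_build fib_graph_edge_iff)
qed

lemma walk_from_lam_inf:
  assumes "walk_from fib_graph q z" "range z \<subseteq> {0, 1}"
  shows "walk_from fib_graph (if q = q1 then q4 else q1) (\<lambda>i. c_suf_inv (\<phi> (c_suf (z i))))"
proof -
  obtain p where p: "p 0 = q" "\<And>i. (p i, z i, p (Suc i)) \<in> fib_graph"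
    using assms(1) unfolding walk_from_def by blast
  have step: "z i = 0 \<and> p i = q1 \<and> p (Suc i) = q1 \<or> z i = 1 \<and> p i \<noteq> q1 \<and> p (Suc i) \<noteq> q1" for i
    using p(2)[of i] range_subsetD[OF assms(2), of i] by (auto simp: fib_graph_edge_iff)
  have "p i = q1 \<longleftrightarrow> q = q1" for i
    using p(1) step by (induction i) auto
  then have "z i = (if q = q1 then 0 else 1)" for i using step[of i] by auto
  then show ?thesis
    unfolding walk_from_def
    by (intro exI[of _ "\<lambda>_. if q = q1 then q4 else q1"]) (auto simp: c_suf_def fib_graph_edge_iff)
qed

lemma H_fib_in_S_fib:
  assumes "s \<in> S_fib"
  shows "H_fib s \<in> S_fib"
proof -
  have letters: "range s \<subseteq> {0, 1, 2}" using assms by (simp add: S_fib_def)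
  obtain q where q: "walk_from fib_graph q s" using assms unfolding S_fib_iff by blast
  define a where "a = s 0"
  define z where "z = shift s"
  have s: "s = [a] \<frown> z" by (simp add: a_def z_def shift_def fun_eq_iff suffix_def conc_def)
  obtain q' where q': "(q, a, q') \<in> fib_graph" "walk_from fib_graph q' z"
    using q unfolding s by (auto simp: walk_from_build)
  consider "a = 2" | "a \<in> {0, 1}" "range z \<subseteq> {0, 1}" | "a \<in> {0, 1}" "2 \<in> range z"
  proof -
    have "a \<in> {0, 1, 2}" "range z \<subseteq> {0, 1, 2}" using letters unfolding s by simp_all
    then have "a = 2 \<or> a \<in> {0, 1}" "range z \<subseteq> {0, 1} \<or> 2 \<in> range z"
      by (simp_all add: image_subset_iff image_iff) metis+
    then show thesis using that by metis
  qed
  then show ?thesis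
  proof cases
    case 1
    then have "walk_from fib_graph (if q = q1 then q4 else q3) ([1] \<frown> z)"
      using q' by (auto simp: walk_from_build fib_graph_edge_iff)
    then show ?thesis unfolding S_fib_iff s 1 H_fib_2 by blast
  next
    case 2
    then show ?thesis
      unfolding S_fib_iff s H_fib_letters[OF 2] using walk_from_lam_inf[OF q'(2)] by blast
  next
    case 3
    \<comment> \<open>Split \<open>z\<close> at its first 2.\<close>
    define r where "r = (LEAST r. z r = 2)"
    have zr: "z r = 2" unfolding r_def using 3(2) by (auto intro: LeastI)
    have "z i \<in> {0, 1}" if "i < r" for i
    proof -
      have "z i \<noteq> 2" using that not_less_Least unfolding r_def by blast
      then show ?thesis
        using range_subsetD[OF letters, of "Suc i"] by (simp add: z_def shift_def suffix_def)
    qed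
    then have x: "prefix r z \<in> lists {0, 1}" by (simp add: in_lists_conv_set subsequence_def)
    have "z = (prefix r z @ [2]) \<frown> suffix (Suc r) z"
      using prefix_suffix[of z "Suc r"] zr by (simp add: subsequence_def)
    then obtain x y where xy: "x \<in> lists {0, 1}" "z = (x @ [2]) \<frown> y" using x by blast
    have "s = ([a] @ x @ [2]) \<frown> y" unfolding s xy(2) by simp
    then show ?thesis
      unfolding S_fib_iff using H_fib_letters_2[OF 3(1) xy(1)] walk_from_lam q'(2) xy by metis
  qed
qed

theorem theorem3:
  shows "regular_language {0, 1, 2} (factors S_fib) \<and>
    (\<forall>s :: nat word. range s \<subseteq> {0, 1, 2} \<longrightarrow>
       (s \<in> S_fib \<longleftrightarrow> infinite_walk_label fib_graph s)) \<and>
    (\<forall>s \<in> S_fib. H_fib s \<in> S_fib \<and>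
       (\<forall>z. s = [2] \<frown> z \<longrightarrow> H_fib s = [1] \<frown> z) \<and>
       (\<forall>a x z. a \<in> {0, 1} \<and> x \<in> lists {0, 1} \<and> s = ([a] @ x @ [2]) \<frown> z \<longrightarrow>
          H_fib s = morph lam (x @ [2]) \<frown> z) \<and>
       (\<forall>a z. a \<in> {0, 1} \<and> range z \<subseteq> {0, 1} \<and> s = [a] \<frown> z \<longrightarrow>
          H_fib s = morph_inf lam z))"
proof (intro conjI ballI allI impI)
  show "regular_language {0, 1, 2} (factors S_fib)"
    unfolding factors_S_fib by (rule regular_language_walk_labels) simp
next
  fix s :: "nat word"
  show "s \<in> S_fib \<longleftrightarrow> infinite_walk_label fib_graph s"
    by (simp add: S_fib_iff infinite_walk_label_iff)
next
  fix s :: "nat word" assume "s \<in> S_fib"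
  then show "H_fib s \<in> S_fib" by (rule H_fib_in_S_fib)
next
  fix s z :: "nat word" assume "s = [2] \<frown> z"
  then show "H_fib s = [1] \<frown> z" using H_fib_2 by simp
next
  fix s z :: "nat word" and a :: nat and x
  assume "a \<in> {0, 1} \<and> x \<in> lists {0, 1} \<and> s = ([a] @ x @ [2]) \<frown> z"
  then show "H_fib s = morph lam (x @ [2]) \<frown> z" using H_fib_letters_2 by blast
next
  fix s z :: "nat word" and a :: nat
  assume "a \<in> {0, 1} \<and> range z \<subseteq> {0, 1} \<and> s = [a] \<frown> z"
  then show "H_fib s = morph_inf lam z" using H_fib_letters morph_inf_lam_letters by metis
qed

end
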